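(* Let $A\in\mathbb{R}^{n\times n}$ be symmetric positive definite, let $\{1,\dots,n\}=\mathcal{F}\cup\mathcal{A}$ be a partition into disjoint sets $\mathcal{F}$ (free set) and $\mathcal{A}$ (active set), and order the indices so that those in $\mathcal{F}$ come first: $$A=\begin{pmatrix}A_{\mathcal{FF}} & A_{\mathcal{FA}}\\ A_{\mathcal{AF}} & A_{\mathcal{AA}}\end{pmatrix}.$$ Let $P_{\mathcal{F}}=\begin{pmatrix} I & 0\\ 0& 0\end{pmatrix}$ (identity on the $\mathcal{F}$ block), $M^{-1}:=P_{\mathcal{F}}A^{-1}P_{\mathcal{F}}$, and $S=A_{\mathcal{FF}}-A_{\mathcal{FA}}A_{\mathcal{AA}}^{-1}A_{\mathcal{AF}}$. Then the error of the approximate preconditioning in face compared to the standard preconditioning in face, i.e. the difference $S^{-1}A_{\mathcal{FF}}-A_{\mathcal{FF}}^{-1}A_{\mathcal{FF}}=S^{-1}A_{\mathcal{FF}}-I$ of the two preconditioned operators on the free set, is $$S^{-1}A_{\mathcal{FF}}-I=A_{\mathcal{FF}}^{-1}A_{\mathcal{FA}}\left(A_{\mathcal{AA}}-A_{\mathcal{AF}}A_{\mathcal{FF}}^{-1}A_{\mathcal{FA}}\right)^{-1}A_{\mathcal{AF}}.$$ Moreover, the non-zero eigenvalues of $M^{-1}A$ (counted with multiplicity) are exactly the eigenvalues of $S^{-1}A_{\mathcal{FF}}$; writing $m=|\mathcal{F}|$ and $r=\operatorname{rank}(A_{\mathcal{AF}})$, these are real and can be ordered as $\lambda_1\le\dots\le\lambda_m$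 with $$1=\lambda_1=\dots=\lambda_{m-r}\le\dots\le\lambda_m,$$ that is, all of them are at least $1$ and the first $m-r$ of them equal $1$.
   Context: For index sets $\mathcal{I},\mathcal{J}$, $A_{\mathcal{IJ}}$ denotes the submatrix of $A$ with rows in $\mathcal{I}$ and columns in $\mathcal{J}$. The symbol $M^{-1}$ is only a name for the (singular in general) matrix $P_{\mathcal{F}}A^{-1}P_{\mathcal{F}}$, called the approximate preconditioner in face; it is not the inverse of a matrix. The $\mathcal{FF}$ block of $M^{-1}$ is $S^{-1}$. The standard preconditioning in face uses instead the matrix $\begin{pmatrix}A_{\mathcal{FF}}^{-1}&0\\0&0\end{pmatrix}$, so that its preconditioned operator on the free set is $A_{\mathcal{FF}}^{-1}A_{\mathcal{FF}}=I$. *)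

theory Defs
  imports
    "Jordan_Normal_Form.Char_Poly"
    "Jordan_Normal_Form.Gauss_Jordan_Elimination"
    "Jordan_Normal_Form.DL_Submatrix"
    "Jordan_Normal_Form.DL_Rank"
begin

definition spd_mat :: "real mat \<Rightarrow> bool" where
  "spd_mat A \<longleftrightarrow> square_mat A \<and> transpose_mat A = A \<and>
     (\<forall>x \<in> carrier_vec (dim_row A). x \<noteq> 0\<^sub>v (dim_row A) \<longrightarrow> x \<bullet> (A *\<^sub>v x) > 0)"

(* Unspecified if A has no inverse; uses of it should come with invertible_mat A. *)
definition mat_inv :: "real mat \<Rightarrow> real mat" where
  "mat_inv A = the (mat_inverse A)"

(* Coordinate projection onto the indices in F. If F = {0..<m}, it is the block matrix
   with an identity block of size m in the upper left corner and zeros elsewhere. *)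
definition face_proj :: "nat \<Rightarrow> nat set \<Rightarrow> real mat" where
  "face_proj n F = mat_diag n (\<lambda>i. if i \<in> F then 1 else 0)"

(* The name M^-1 for this matrix is conventional: it is singular unless F is everything. *)
definition approx_face_precond :: "real mat \<Rightarrow> nat set \<Rightarrow> real mat" where
  "approx_face_precond A F =
     face_proj (dim_row A) F * mat_inv A * face_proj (dim_row A) F"

(* All complex eigenvalues of a real square matrix, with algebraic multiplicity. *)
definition eigenvalues_mset :: "real mat \<Rightarrow> complex multiset" where
  "eigenvalues_mset A = proots (char_poly (map_mat complex_of_real A))"

end

(* Let E_I be the n x |I| matrix whose columns are the unit vectors indexed by I, so that
   A_IJ = E_I^T A E_J and the projection onto I is E_I E_I^T; blocks with respect to the
   non-contiguous sets F and Act can then be multiplied as usual. With B = A^{-1}, the block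
   form of B A = I gives B_FF S = I and B_AA T = I, T being the other Schur complement, and the
   block form of A B = I gives S^{-1} A_FF - I = - B_FA A_AF = A_FF^{-1} A_FA T^{-1} A_AF.

   M^{-1} A and S^{-1} A_FF are products X Y and Y X of the same rectangular matrices, so
   Sylvester's identity c^r det(c I - X Y) = c^m det(c I - Y X) matches their non-zero
   eigenvalues. The same identity with c = x - 1, applied to the error term after a rank
   factorization of A_AF, gives the eigenvalue 1 the multiplicity at least m - r. Finally
   A_FF S^{-1} A_FF = A_FF + A_FA B_AA A_AF is symmetric and dominates A_FF, which makes all
   eigenvalues real and at least 1. *)
theory Submission
  imports Defs "HOL-Computational_Algebra.Fundamental_Theorem_Algebra"
begin

subsection \<open>Sylvester's determinant identity\<close>

lemma mult_assoc_dim: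
  "dim_col A = dim_row B \<Longrightarrow> dim_col B = dim_row C \<Longrightarrow> (A * B) * C = A * (B * C)"
  for A B C :: "'a :: semiring_0 mat"
  by (rule assoc_mult_mat[of _ "dim_row A" "dim_col A" _ "dim_col B" _ "dim_col C"]) auto

lemma mult_mat_vec_assoc_dim:
  "dim_col A = dim_row B \<Longrightarrow> dim_col B = dim_vec v \<Longrightarrow> (A * B) *\<^sub>v v = A *\<^sub>v (B *\<^sub>v v)"
  for A B :: "'a :: semiring_0 mat"
  by (rule assoc_mult_mat_vec[of _ "dim_row A" "dim_col A" _ "dim_col B"]) (auto intro: carrier_vecI)

lemma transpose_mult_dim:
  "dim_col A = dim_row B \<Longrightarrow> (A * B)\<^sup>T = B\<^sup>T * A\<^sup>T"
  for A B :: "'a :: comm_semiring_0 mat"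
  by (rule transpose_mult[of _ "dim_row A" "dim_col A" _ "dim_col B"]) auto

lemma mult_mat_vec_zero:
  "A \<in> carrier_mat k n \<Longrightarrow> A *\<^sub>v 0\<^sub>v n = 0\<^sub>v k"
  for A :: "'a :: semiring_0 mat"
  by (intro eq_vecI) (auto simp: scalar_prod_def)

lemma det_smult_one_minus_mult_commute:
  fixes X Y :: "'a :: idom mat"
  assumes X: "X \<in> carrier_mat m r" and Y: "Y \<in> carrier_mat r m"
  shows "c ^ r * det (c \<cdot>\<^sub>m 1\<^sub>m m - X * Y) = c ^ m * det (c \<cdot>\<^sub>m 1\<^sub>m r - Y * X)"
proof -
  \<comment> \<open>Both sides are read off from \<open>det ?B\<close> by clearing one off-diagonal block, on the right by \<open>?R\<close>
    with determinant \<open>c ^ r\<close>, so that no division is needed.\<close>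
  let ?B = "four_block_mat (c \<cdot>\<^sub>m 1\<^sub>m m) X Y (1\<^sub>m r)"
  let ?L = "four_block_mat (1\<^sub>m m) (0\<^sub>m m r) (- Y) (1\<^sub>m r)"
  let ?R = "four_block_mat (1\<^sub>m m) (- X) (0\<^sub>m r m) (c \<cdot>\<^sub>m 1\<^sub>m r)"
  have B: "?B \<in> carrier_mat (m + r) (m + r)" and L: "?L \<in> carrier_mat (m + r) (m + r)"
    and R: "?R \<in> carrier_mat (m + r) (m + r)"
    using X Y by auto
  have BL: "?B * ?L = four_block_mat (c \<cdot>\<^sub>m 1\<^sub>m m - X * Y) X (0\<^sub>m r m) (1\<^sub>m r)"
    by (subst mult_four_block_mat[of _ m m _ r _ r _ _ m _ r])
      (use X Y in \<open>auto intro!: cong_four_block_mat\<close>)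
  have BR: "?B * ?R = four_block_mat (c \<cdot>\<^sub>m 1\<^sub>m m) (0\<^sub>m m r) Y (c \<cdot>\<^sub>m 1\<^sub>m r - Y * X)"
    by (subst mult_four_block_mat[of _ m m _ r _ r _ _ m _ r])
      (use X Y in \<open>auto intro!: cong_four_block_mat\<close>)
  have "det ?B * det ?L = det (c \<cdot>\<^sub>m 1\<^sub>m m - X * Y)"
    unfolding det_mult[OF B L, symmetric] BL
    by (subst det_four_block_mat_lower_left_zero[of _ m _ r]) (use X Y in auto)
  moreover have "det ?L = 1"
    by (subst det_four_block_mat_upper_right_zero[of _ m _ r]) (use X Y in auto)
  moreover have "det ?B * det ?R = c ^ m * det (c \<cdot>\<^sub>m 1\<^sub>m r - Y * X)"
    unfolding det_mult[OF B R, symmetric] BR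
    by (subst det_four_block_mat_upper_right_zero[of _ m _ r]) (use X Y in auto)
  moreover have "det ?R = c ^ r"
    by (subst det_four_block_mat_lower_left_zero[of _ m _ r]) (use X Y in auto)
  ultimately show ?thesis by (simp add: mult.commute)
qed

text \<open>Sylvester's identity over the polynomial ring with \<open>c = x - a\<close>, because
  \<open>x I - (a I + X Y) = (x - a) I - X Y\<close>. It is used with \<open>a = 0\<close> and with
  \<open>a = 1\<close>.\<close>

lemma char_poly_smult_one_plus_mult_commute:
  fixes X Y :: "'a :: idom mat"
  assumes X: "X \<in> carrier_mat m r" and Y: "Y \<in> carrier_mat r m"
  shows "[:- a, 1:] ^ r * char_poly (a \<cdot>\<^sub>m 1\<^sub>m m + X * Y) =
    [:- a, 1:] ^ m * char_poly (a \<cdot>\<^sub>m 1\<^sub>m r + Y * X)"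
proof -
  let ?h = "map_mat (\<lambda>a. [:a:])"
  interpret comm_ring_hom "\<lambda>a::'a. [:a:]" by unfold_locales (auto simp: one_pCons)
  have cp: "char_poly (a \<cdot>\<^sub>m 1\<^sub>m k + V * W) = det ([:- a, 1:] \<cdot>\<^sub>m 1\<^sub>m k - ?h V * ?h W)"
    if "V \<in> carrier_mat k l" "W \<in> carrier_mat l k" for V W :: "'a mat" and k l
    unfolding char_poly_defs mat_hom_mult[OF that, symmetric] using that
    by (intro arg_cong[of _ _ det] eq_matI) auto
  show ?thesis unfolding cp[OF X Y] cp[OF Y X]
    by (rule det_smult_one_minus_mult_commute) (use X Y in auto)
qed

subsection \<open>Submatrices as two-sided products with selection matrices\<close>

text \<open>This is \<open>E_I\<close>. Since \<open>pick I\<close> enumerates \<open>I\<close>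
  increasingly from index 0, its columns come in the order in which \<open>submatrix\<close>
  arranges rows and columns.\<close>

definition sel :: "nat \<Rightarrow> nat set \<Rightarrow> real mat" where
  "sel n I = mat n (card I) (\<lambda>(i, j). if i = pick I j then 1 else 0)"

lemma sel_carrier [simp]: "sel n I \<in> carrier_mat n (card I)"
  and sel_dim [simp]: "dim_row (sel n I) = n" "dim_col (sel n I) = card I"
  by (auto simp: sel_def)

lemma pick_less_bound: "I \<subseteq> {0..<n} \<Longrightarrow> i < card I \<Longrightarrow> pick I i < n"
  using pick_in_set_le by fastforce

lemma bij_betw_pick: "finite I \<Longrightarrow> bij_betw (pick I) {0..<card I} I"
proof -
  assume I: "finite I"
  have inj: "inj_on (pick I) {0..<card I}"
    by (rule inj_onI) (metis atLeastLessThan_iff nat_neq_iff pick_mono_le)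
  have "pick I ` {0..<card I} \<subseteq> I" using pick_in_set_le by auto
  then have "pick I ` {0..<card I} = I"
    by (rule card_subset_eq[OF I]) (simp add: card_image[OF inj])
  with inj show ?thesis by (simp add: bij_betw_def)
qed

lemma submatrix_eq_sel:
  assumes A: "A \<in> carrier_mat n n" and I: "I \<subseteq> {0..<n}" and J: "J \<subseteq> {0..<n}"
  shows "submatrix A I J = (sel n I)\<^sup>T * A * sel n J"
proof -
  \<comment> \<open>\<open>submatrix\<close> takes its dimensions from the indices below
    \<open>n\<close> that lie in the set; for a set within range this is its cardinality.\<close>
  have c: "card {i. i < n \<and> i \<in> K} = card K" if "K \<subseteq> {0..<n}" for K
    using that by (intro arg_cong[of _ _ card]) auto
  have 1: "((sel n I)\<^sup>T * A) $$ (i, j) = A $$ (pick I i, j)" if "i < card I" "j < n" for i j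
    using that A pick_less_bound[OF I that(1)]
    by (simp add: sel_def scalar_prod_def if_distrib[of "\<lambda>x. x * _"] cong: if_cong)
  show ?thesis
  proof (rule eq_matI)
    fix i j assume "i < dim_row ((sel n I)\<^sup>T * A * sel n J)" "j < dim_col ((sel n I)\<^sup>T * A * sel n J)"
    then have ij: "i < card I" "j < card J" by auto
    have "((sel n I)\<^sup>T * A * sel n J) $$ (i, j) =
        (\<Sum>k\<in>{0..<n}. ((sel n I)\<^sup>T * A) $$ (i, k) * sel n J $$ (k, j))"
      using ij A by (auto simp: scalar_prod_def)
    also have "\<dots> = (\<Sum>k\<in>{0..<n}. A $$ (pick I i, k) * sel n J $$ (k, j))"
      using ij by (intro sum.cong refl) (simp only: 1 atLeastLessThan_iff)
    also have "\<dots> = A $$ (pick I i, pick J j)"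
      using ij pick_less_bound[OF J ij(2)]
      by (simp add: sel_def if_distrib[of "\<lambda>x. _ * x"] cong: if_cong)
    finally show "submatrix A I J $$ (i, j) = ((sel n I)\<^sup>T * A * sel n J) $$ (i, j)"
      using ij A c[OF I] c[OF J] by (simp add: submatrix_index)
  qed (use A c[OF I] c[OF J] in \<open>simp_all add: dim_submatrix\<close>)
qed

lemma sel_transpose_sel:
  assumes "I \<subseteq> {0..<n}"
  shows "(sel n I)\<^sup>T * sel n I = 1\<^sub>m (card I)"
proof (rule eq_matI)
  fix i j assume "i < dim_row (1\<^sub>m (card I) :: real mat)" "j < dim_col (1\<^sub>m (card I) :: real mat)"
  then have ij: "i < card I" "j < card I" by auto
  have "pick I i = pick I j \<longleftrightarrow> i = j" using ij by (metis nat_neq_iff pick_mono_le)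
  then show "((sel n I)\<^sup>T * sel n I) $$ (i, j) = (1\<^sub>m (card I) :: real mat) $$ (i, j)"
    using ij pick_less_bound[OF assms ij(1)]
    by (simp add: sel_def scalar_prod_def if_distrib[of "\<lambda>x. x * _"] cong: if_cong)
qed auto

lemma sel_transpose_sel_disjoint:
  assumes "I \<subseteq> {0..<n}" "I \<inter> J = {}"
  shows "(sel n I)\<^sup>T * sel n J = 0\<^sub>m (card I) (card J)"
proof (rule eq_matI)
  fix i j assume "i < dim_row (0\<^sub>m (card I) (card J) :: real mat)"
    "j < dim_col (0\<^sub>m (card I) (card J) :: real mat)"
  then have ij: "i < card I" "j < card J" by auto
  have "pick I i \<noteq> pick J j" using pick_in_set_le[OF ij(1)] pick_in_set_le[OF ij(2)] assms by auto
  then show "((sel n I)\<^sup>T * sel n J) $$ (i, j) = (0\<^sub>m (card I) (card J) :: real mat) $$ (i, j)"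
    using ij pick_less_bound[OF assms(1) ij(1)]
    by (simp add: sel_def scalar_prod_def if_distrib[of "\<lambda>x. x * _"] cong: if_cong)
qed auto

lemma sel_sel_transpose:
  assumes I: "I \<subseteq> {0..<n}"
  shows "sel n I * (sel n I)\<^sup>T = face_proj n I"
proof (rule eq_matI)
  fix i j assume "i < dim_row (face_proj n I)" "j < dim_col (face_proj n I)"
  then have ij: "i < n" "j < n" by (auto simp: face_proj_def mat_diag_def)
  have fin: "finite I" using I finite_subset by blast
  \<comment> \<open>The summand is written as a function of \<open>pick I k\<close>, so that the
    bijection turns the sum over columns into a sum over \<open>I\<close>, where at most one term
    survives.\<close>
  have "(sel n I * (sel n I)\<^sup>T) $$ (i, j) =
      (\<Sum>k\<in>{0..<card I}. (\<lambda>a. if a = i \<and> a = j then 1 else 0) (pick I k))"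
    using ij by (auto simp: sel_def scalar_prod_def intro!: sum.cong)
  also have "\<dots> = (\<Sum>a\<in>I. if a = i \<and> a = j then 1 else 0)"
    by (rule sum.reindex_bij_betw[OF bij_betw_pick[OF fin]])
  also have "\<dots> = (\<Sum>a\<in>I. if a = i then (if i = j then 1 else 0) else 0)"
    by (intro sum.cong) auto
  also have "\<dots> = face_proj n I $$ (i, j)"
    using ij fin by (auto simp: face_proj_def mat_diag_def)
  finally show "(sel n I * (sel n I)\<^sup>T) $$ (i, j) = face_proj n I $$ (i, j)" .
qed (auto simp: face_proj_def mat_diag_def)

lemma face_proj_add_complement:
  assumes "I \<union> J = {0..<n}" "I \<inter> J = {}"
  shows "face_proj n I + face_proj n J = 1\<^sub>m n"
  using assms by (intro eq_matI) (auto simp: face_proj_def mat_diag_def)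

subsection \<open>Symmetric positive definite matrices\<close>

text \<open>The quadratic form of the submatrix at \<open>x\<close> is that of \<open>A\<close> at
  \<open>y = E_I x\<close>, and \<open>y\<close> is non-zero because
  \<open>E_I^T y = x\<close>.\<close>

lemma spd_mat_submatrix:
  assumes A: "A \<in> carrier_mat n n" "spd_mat A" and I: "I \<subseteq> {0..<n}"
  shows "submatrix A I I \<in> carrier_mat (card I) (card I)" "spd_mat (submatrix A I I)"
proof -
  note E = submatrix_eq_sel[OF A(1) I I]
  show C: "submatrix A I I \<in> carrier_mat (card I) (card I)" unfolding E using A by auto
  have "(submatrix A I I)\<^sup>T = submatrix A I I"
    using A unfolding E spd_mat_def
    by (simp add: transpose_mult_dim mult_assoc_dim)
  moreover have "x \<bullet> (submatrix A I I *\<^sub>v x) > 0"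
    if x: "x \<in> carrier_vec (card I)" "x \<noteq> 0\<^sub>v (card I)" for x
  proof -
    let ?y = "sel n I *\<^sub>v x"
    have y: "?y \<in> carrier_vec n" using x by (intro mult_mat_vec_carrier[OF sel_carrier])
    have "(sel n I)\<^sup>T *\<^sub>v ?y = x"
      using x by (simp add: mult_mat_vec_assoc_dim[symmetric] sel_transpose_sel[OF I])
    with x have "?y \<noteq> 0\<^sub>v n"
      by (metis mult_mat_vec_zero sel_carrier transpose_carrier_mat)
    with A y have "?y \<bullet> (A *\<^sub>v ?y) > 0" by (auto simp: spd_mat_def)
    also have "?y \<bullet> (A *\<^sub>v ?y) = x \<bullet> ((sel n I)\<^sup>T *\<^sub>v (A *\<^sub>v ?y))"
      using x transpose_vec_mult_scalar[of "(sel n I)\<^sup>T" "card I" n "A *\<^sub>v ?y" x]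
        mult_mat_vec_carrier[OF A(1) y] by simp
    also have "\<dots> = x \<bullet> (submatrix A I I *\<^sub>v x)"
      unfolding E using A x by (simp add: mult_mat_vec_assoc_dim)
    finally show ?thesis .
  qed
  ultimately show "spd_mat (submatrix A I I)" using C by (auto simp: spd_mat_def)
qed

text \<open>Reduces the computation of \<open>mat_inv\<close> to exhibiting a left inverse: for
  square matrices it is two-sided, and uniqueness identifies it with the result of
  \<open>mat_inverse\<close>.\<close>

lemma mat_inv_unique:
  assumes A: "A \<in> carrier_mat n n" and B: "B \<in> carrier_mat n n" and BA: "B * A = 1\<^sub>m n"
  shows "invertible_mat A" "mat_inv A = B"
proof -
  have AB: "A * B = 1\<^sub>m n" by (rule mat_mult_left_right_inverse[OF B A BA])
  show "invertible_mat A"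
    using A B AB BA by (auto simp: invertible_mat_def inverts_mat_def intro!: exI[of _ B])
  have "A \<in> Units (ring_mat TYPE(real) n ())"
    using A B AB BA by (auto simp: Units_def ring_mat_simps)
  then obtain C where C: "mat_inverse A = Some C"
    using mat_inverse(1)[OF A, where b = "()"] by (cases "mat_inverse A") auto
  from mat_inverse(2)[OF A C] have AC: "A * C = 1\<^sub>m n" and Cc: "C \<in> carrier_mat n n" by auto
  have "C = B * A * C" using BA Cc by simp
  also have "\<dots> = B" using A B Cc AC by (simp add: mult_assoc_dim)
  finally show "mat_inv A = B" using C by (simp add: mat_inv_def)
qed

lemma spd_mat_inv:
  assumes A: "A \<in> carrier_mat n n" "spd_mat A"
  shows "invertible_mat A" "mat_inv A \<in> carrier_mat n n"
    "A * mat_inv A = 1\<^sub>m n" "mat_inv A * A = 1\<^sub>m n"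
proof -
  \<comment> \<open>The quadratic form vanishes at a kernel vector, so positivity forces that vector
    to be zero.\<close>
  have "x = 0\<^sub>v n" if "x \<in> carrier_vec n" "A *\<^sub>v x = 0\<^sub>v n" for x
    using A that by (force simp: spd_mat_def)
  then have "det A \<noteq> 0" by (auto simp: det_0_iff_vec_prod_zero_field[OF A(1)])
  from det_non_zero_imp_unit[OF A(1) this, of "()"]
  obtain B where B: "B \<in> carrier_mat n n" "B * A = 1\<^sub>m n"
    by (auto simp: Units_def ring_mat_simps)
  from mat_inv_unique[OF A(1) B] B mat_mult_left_right_inverse[OF B(1) A(1) B(2)]
  show "invertible_mat A" "mat_inv A \<in> carrier_mat n n"
    "A * mat_inv A = 1\<^sub>m n" "mat_inv A * A = 1\<^sub>m n" by simp_all
qed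

text \<open>Symmetry holds because the transposed inverse is again a left inverse of
  \<open>A\<close>. For positivity, the form at \<open>x\<close> equals the form of \<open>A\<close>
  at \<open>y = A^{-1} x\<close>.\<close>

lemma spd_mat_mat_inv:
  assumes A: "A \<in> carrier_mat n n" "spd_mat A"
  shows "spd_mat (mat_inv A)"
proof -
  let ?B = "mat_inv A"
  note B = spd_mat_inv[OF A]
  have sym: "A\<^sup>T = A" using A by (auto simp: spd_mat_def)
  have "?B\<^sup>T * A = (A * ?B)\<^sup>T" using A B(2) sym by (simp add: transpose_mult_dim)
  also have "\<dots> = 1\<^sub>m n" using B by simp
  finally have symB: "?B\<^sup>T = ?B" using mat_inv_unique(2)[OF A(1), of "?B\<^sup>T"] B by simp
  have "x \<bullet> (?B *\<^sub>v x) > 0" if x: "x \<in> carrier_vec n" "x \<noteq> 0\<^sub>v n" for x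
  proof -
    let ?y = "?B *\<^sub>v x"
    have y: "?y \<in> carrier_vec n" using B x by auto
    have Ay: "A *\<^sub>v ?y = x"
      using A B x by (simp add: mult_mat_vec_assoc_dim[symmetric])
    with x A have "?y \<noteq> 0\<^sub>v n" by (metis mult_mat_vec_zero)
    with A y have "?y \<bullet> (A *\<^sub>v ?y) > 0" by (auto simp: spd_mat_def)
    then show ?thesis unfolding Ay using x y by (simp add: comm_scalar_prod[of _ n])
  qed
  with B(2) symB show ?thesis by (auto simp: spd_mat_def)
qed

subsection \<open>Rank factorization and eigenvalues\<close>

text \<open>\<open>U\<close> lists a maximal linearly independent set of columns of
  \<open>C\<close>; column \<open>j\<close> of \<open>V\<close> holds the coefficients of column
  \<open>j\<close> of \<open>C\<close> over that set.\<close>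

lemma (in vec_space) rank_factorization:
  assumes C: "C \<in> carrier_mat n m"
  shows "\<exists>U V. U \<in> carrier_mat n (rank C) \<and> V \<in> carrier_mat (rank C) m \<and> C = U * V"
proof -
  have colsC: "set (cols C) \<subseteq> carrier_vec n" using cols_dim C by blast
  obtain T where fin: "finite T" and mx: "maximal T (\<lambda>T. T \<subseteq> set (cols C) \<and> lin_indpt T)"
    using maximal_exists_superset[of "set (cols C)" "\<lambda>T. T \<subseteq> set (cols C) \<and> lin_indpt T" "{}"]
    by (auto simp: lin_dep_def)
  have T: "T \<subseteq> set (cols C)" "lin_indpt T" using mx by (auto simp: maximal_def)
  have r: "rank C = card T" by (rule rank_card_indpt[OF C mx])
  \<comment> \<open>A column outside the span could be added to \<open>T\<close>, against
    maximality.\<close>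
  have spanT: "c \<in> span T" if c: "c \<in> set (cols C)" for c
  proof (rule ccontr)
    assume nc: "c \<notin> span T"
    have "lin_indpt (T \<union> {c})"
      using lin_dep_iff_in_span[of T c] T c nc colsC span_mem[of T c] by auto
    then have "T \<union> {c} = T" using mx T c by (auto simp: maximal_def)
    with nc span_mem[of T c] T colsC show False by auto
  qed
  obtain us where us: "set us = T" "distinct us" using finite_distinct_list[OF fin] by auto
  define U where "U = mat_of_cols n us"
  have len: "length us = rank C" using us r distinct_card by force
  have U: "U \<in> carrier_mat n (rank C)" unfolding U_def using len by auto
  have colsU: "cols U = us" unfolding U_def using us T colsC by (intro cols_mat_of_cols) auto
  have "\<exists>v. v \<in> carrier_vec (rank C) \<and> U *\<^sub>v v = col C j" if "j < m" for j
  proof -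
    have "col C j \<in> set (cols C)" using that C by (auto simp: cols_def)
    then have "col C j \<in> span T" by (rule spanT)
    then obtain a where "lincomb a T = col C j"
      using finite_in_span[OF fin] T(1) colsC by (metis subset_trans)
    \<comment> \<open>\<open>lincomb\<close> attaches coefficients to vectors, so entry
      \<open>i\<close> is the coefficient of column \<open>i\<close> of \<open>U\<close>;
      distinctness of \<open>us\<close> keeps any vector from being counted twice.\<close>
    then show ?thesis
      using mat_mult_eq_lincomb[OF U, of a] colsU us
      by (intro exI[of _ "vec (rank C) (\<lambda>i. a (col U i))"]) auto
  qed
  then obtain v where v: "\<And>j. j < m \<Longrightarrow> v j \<in> carrier_vec (rank C) \<and> U *\<^sub>v v j = col C j"
    by metis
  define V where "V = mat_of_cols (rank C) (map v [0..<m])"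
  have V: "V \<in> carrier_mat (rank C) m" by (auto simp: V_def)
  have "C = U * V"
  proof (rule mat_col_eqI)
    fix j assume "j < dim_col (U * V)"
    then have j: "j < m" using V by auto
    have "col V j = v j" unfolding V_def using j v by (subst col_mat_of_cols) auto
    then show "col C j = col (U * V) j" using j v by (simp add: col_mult2[OF U V])
  qed (use U V C in auto)
  with U V show ?thesis by blast
qed

text \<open>Writing the eigenvector as \<open>x + \<i>y\<close> with real \<open>x\<close>, \<open>y\<close> keeps all quadratic forms real.\<close>

lemma pencil_eigenvalue_real_ge_one:
  assumes P: "P \<in> carrier_mat m m" "spd_mat P" and N: "N \<in> carrier_mat m m"
    and sym: "(P * N)\<^sup>T = P * N"
    and ge: "\<And>x. x \<in> carrier_vec m \<Longrightarrow> x \<bullet> (P *\<^sub>v x) \<le> x \<bullet> ((P * N) *\<^sub>v x)"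
    and z: "eigenvalue (map_mat complex_of_real N) z"
  shows "Im z = 0" "Re z \<ge> 1"
proof -
  let ?N = "map_mat complex_of_real N" and ?R = "P * N"
  obtain v where v: "v \<in> carrier_vec m" "v \<noteq> 0\<^sub>v m" "?N *\<^sub>v v = z \<cdot>\<^sub>v v"
    using z N by (auto simp: eigenvalue_def eigenvector_def)
  define x y where "x = map_vec Re v" and "y = map_vec Im v"
  have x: "x \<in> carrier_vec m" and y: "y \<in> carrier_vec m" using v by (auto simp: x_def y_def)
  \<comment> \<open>Real and imaginary parts of \<open>N v = z v\<close>.\<close>
  have Nx: "N *\<^sub>v x = Re z \<cdot>\<^sub>v x - Im z \<cdot>\<^sub>v y" and Ny: "N *\<^sub>v y = Re z \<cdot>\<^sub>v y + Im z \<cdot>\<^sub>v x"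
  proof -
    have i: "(?N *\<^sub>v v) $ i = z * v $ i" if "i < m" for i using v that by simp
    have "(N *\<^sub>v x) $ i = Re ((?N *\<^sub>v v) $ i)" "(N *\<^sub>v y) $ i = Im ((?N *\<^sub>v v) $ i)" if "i < m" for i
      using that N v(1) by (simp_all add: scalar_prod_def x_def y_def)
    with i x y N v show "N *\<^sub>v x = Re z \<cdot>\<^sub>v x - Im z \<cdot>\<^sub>v y" "N *\<^sub>v y = Re z \<cdot>\<^sub>v y + Im z \<cdot>\<^sub>v x"
      by (auto intro!: eq_vecI simp: x_def y_def)
  qed
  have Px: "P *\<^sub>v x \<in> carrier_vec m" and Py: "P *\<^sub>v y \<in> carrier_vec m" using P x y by auto
  have Rx: "?R *\<^sub>v x = Re z \<cdot>\<^sub>v (P *\<^sub>v x) - Im z \<cdot>\<^sub>v (P *\<^sub>v y)"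
    using P N x y by (simp add: mult_mat_vec_assoc_dim Nx mult_minus_distrib_mat_vec[of _ m m] mult_mat_vec[of _ m m])
  have Ry: "?R *\<^sub>v y = Re z \<cdot>\<^sub>v (P *\<^sub>v y) + Im z \<cdot>\<^sub>v (P *\<^sub>v x)"
    using P N x y by (simp add: mult_mat_vec_assoc_dim Ny mult_add_distrib_mat_vec[of _ m m] mult_mat_vec[of _ m m])
  have symm: "y \<bullet> (M *\<^sub>v x) = x \<bullet> (M *\<^sub>v y)" if "M \<in> carrier_mat m m" "M\<^sup>T = M" for M
    using transpose_vec_mult_scalar[OF that(1) y x] that x y
      comm_scalar_prod[of "M *\<^sub>v y" m x] by (simp add: comm_scalar_prod[of y m])
  have R: "?R \<in> carrier_mat m m" using P N by auto
  have Psym: "P\<^sup>T = P" using P by (auto simp: spd_mat_def)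
  let ?xx = "x \<bullet> (P *\<^sub>v x)" and ?yy = "y \<bullet> (P *\<^sub>v y)"
  have pos: "w \<bullet> (P *\<^sub>v w) > 0" if "w \<in> carrier_vec m" "w \<noteq> 0\<^sub>v m" for w
    using P that by (auto simp: spd_mat_def)
  have nn: "w \<bullet> (P *\<^sub>v w) \<ge> 0" if "w \<in> carrier_vec m" for w
    using pos[OF that] P by (cases "w = 0\<^sub>v m") auto
  have "x \<noteq> 0\<^sub>v m \<or> y \<noteq> 0\<^sub>v m"
  proof (rule ccontr)
    assume "\<not> ?thesis"
    then have "Re (v $ i) = 0 \<and> Im (v $ i) = 0" if "i < m" for i
      using that v(1) unfolding x_def y_def by (metis carrier_vecD index_map_vec(1) index_zero_vec(1))
    then have "v = 0\<^sub>v m" using v(1) by (intro eq_vecI) (auto simp: complex_eq_iff)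
    with v show False by simp
  qed
  then have s: "?xx + ?yy > 0"
    using pos[OF x] pos[OF y] nn[OF x] nn[OF y] by fastforce
  \<comment> \<open>The cross terms agree by symmetry of \<open>?R\<close>; subtracting them leaves
    \<open>Im z\<close> times the positive number \<open>?xx + ?yy\<close>.\<close>
  have "y \<bullet> (?R *\<^sub>v x) = Re z * (x \<bullet> (P *\<^sub>v y)) - Im z * ?yy"
    using x y Px Py by (simp add: Rx scalar_prod_minus_distrib[of _ m] symm[OF P(1) Psym])
  moreover have "x \<bullet> (?R *\<^sub>v y) = Re z * (x \<bullet> (P *\<^sub>v y)) + Im z * ?xx"
    using x y Px Py by (simp add: Ry scalar_prod_add_distrib[of _ m])
  ultimately have "Im z * (?xx + ?yy) = 0"
    using symm[OF R sym] by (simp add: algebra_simps)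
  with s show 0: "Im z = 0" by simp
  \<comment> \<open>One of \<open>x\<close>, \<open>y\<close> may be zero and only
    \<open>?xx + ?yy\<close> is known to be positive, so the inequalities at \<open>x\<close> and
    \<open>y\<close> are added before cancelling.\<close>
  have "x \<bullet> (?R *\<^sub>v x) = Re z * ?xx" "y \<bullet> (?R *\<^sub>v y) = Re z * ?yy"
    using x y Px Py 0
    by (simp_all add: Rx Ry scalar_prod_minus_distrib[of _ m] scalar_prod_add_distrib[of _ m])
  with ge[OF x] ge[OF y] have "1 * (?xx + ?yy) \<le> Re z * (?xx + ?yy)" by (simp add: algebra_simps)
  with s show "Re z \<ge> 1" by (simp only: mult_le_cancel_right_pos)
qed

text \<open>An entry \<open>ls ! i\<close> other than the lower bound \<open>a\<close> exceeds it,
  so by sortedness all copies of \<open>a\<close> sit before position \<open>i\<close>: at most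
  \<open>i < k\<close> of them.\<close>

lemma sorted_nth_eq_least_if_count:
  fixes ls :: "'a :: linorder list"
  assumes "sorted ls" "\<forall>x\<in>set ls. a \<le> x" "k \<le> count (mset ls) a" "i < k"
  shows "ls ! i = a"
proof (rule ccontr)
  assume ne: "ls ! i \<noteq> a"
  have "count (mset ls) a = card {j. j < length ls \<and> ls ! j = a}"
    unfolding count_mset count_list_eq_length_filter length_filter_conv_card
    by (rule arg_cong[of _ _ card]) auto
  also have "\<dots> \<le> card {..<i}"
  proof (rule card_mono)
    show "{j. j < length ls \<and> ls ! j = a} \<subseteq> {..<i}"
    proof clarify
      fix j assume j: "j < length ls" "a = ls ! j"
      show "j < i"
      proof (rule ccontr)
        assume "\<not> j < i"
        with j assms(1) have "ls ! i \<le> a" "i < length ls" by (auto simp: sorted_iff_nth_mono)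
        with assms(2) ne show False by (meson nth_mem order_antisym)
      qed
    qed
  qed simp
  finally show False using assms by simp
qed

lemma char_poly_nonzero: "A \<in> carrier_mat n n \<Longrightarrow> char_poly A \<noteq> 0"
  for A :: "'a :: comm_ring_1 mat"
  using degree_monic_char_poly[of A n] by auto

lemma eigenvalue_iff_in_eigenvalues_mset:
  assumes N: "N \<in> carrier_mat m m"
  shows "z \<in># eigenvalues_mset N \<longleftrightarrow> eigenvalue (map_mat complex_of_real N) z"
proof -
  have N': "map_mat complex_of_real N \<in> carrier_mat m m" using N by simp
  then have "char_poly (map_mat complex_of_real N) \<noteq> 0" by (rule char_poly_nonzero)
  then show ?thesis by (simp add: eigenvalues_mset_def eigenvalue_root_char_poly[OF N'])
qed

text \<open>When all eigenvalues are real, passing to real parts loses nothing, and sorting these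
  gives the list.\<close>

lemma sorted_eigenvalue_list:
  assumes N: "N \<in> carrier_mat m m"
    and real: "\<And>z. z \<in># eigenvalues_mset N \<Longrightarrow> Im z = 0 \<and> a \<le> Re z"
    and k: "k \<le> count (eigenvalues_mset N) (complex_of_real a)"
  shows "\<exists>ls. length ls = m \<and> sorted ls \<and>
    eigenvalues_mset N = image_mset complex_of_real (mset ls) \<and>
    (\<forall>i < m. a \<le> ls ! i) \<and> (\<forall>i < k. ls ! i = a)"
proof -
  let ?M = "eigenvalues_mset N"
  define ls where "ls = sorted_list_of_multiset (image_mset Re ?M)"
  have ms: "mset ls = image_mset Re ?M" by (simp add: ls_def)
  have N': "map_mat complex_of_real N \<in> carrier_mat m m" using N by simp
  have "length ls = size ?M" by (metis ms size_image_mset size_mset)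
  \<comment> \<open>Over the complex numbers a polynomial of degree \<open>m\<close> has exactly
    \<open>m\<close> roots with multiplicity.\<close>
  also have "\<dots> = m"
    using degree_monic_char_poly[OF N'] by (simp add: eigenvalues_mset_def size_proots_complex)
  finally have len: "length ls = m" .
  have srt: "sorted ls" by (simp add: ls_def)
  have "image_mset (\<lambda>z. complex_of_real (Re z)) ?M = image_mset id ?M"
    by (intro image_mset_cong) (simp add: real complex_eq_iff)
  then have M: "?M = image_mset complex_of_real (mset ls)"
    by (simp add: ms multiset.map_comp comp_def)
  have "set ls = Re ` set_mset ?M" by (metis ms set_mset_mset set_image_mset)
  then have ge: "\<forall>x\<in>set ls. a \<le> x" using real by auto
  have "count ?M (complex_of_real a) = count (mset ls) a"
    unfolding M by (induction ls) auto
  with k have "\<forall>i < k. ls ! i = a"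
    using sorted_nth_eq_least_if_count[OF srt ge] by auto
  with len srt M ge show ?thesis by (intro exI[of _ ls]) auto
qed

text \<open>With \<open>p\<close>, \<open>q\<close> the characteristic polynomials of
  \<open>I + X Y\<close> and \<open>I + Y X\<close>, the identity for \<open>a = 1\<close> reads
  \<open>(x - 1)^r p = (x - 1)^m q\<close>; cancelling leaves the factor
  \<open>(x - 1)^(m - r)\<close> in \<open>p\<close>.\<close>

lemma count_one_eigenvalues_mset:
  assumes X: "X \<in> carrier_mat m r" and Y: "Y \<in> carrier_mat r m" and rm: "r \<le> m"
  shows "m - r \<le> count (eigenvalues_mset (1\<^sub>m m + X * Y)) 1"
proof -
  let ?h = "map_mat complex_of_real"
  let ?p = "char_poly (?h (1\<^sub>m m + X * Y))" and ?q = "char_poly (1\<^sub>m r + ?h Y * ?h X)"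
  have h: "?h (1\<^sub>m m + X * Y) = 1\<^sub>m m + ?h X * ?h Y"
    unfolding of_real_hom.mat_hom_mult[OF X Y, symmetric] using X Y by (intro eq_matI) auto
  have sm: "1 \<cdot>\<^sub>m 1\<^sub>m j = (1\<^sub>m j :: complex mat)" for j by (intro eq_matI) auto
  have "[:- 1, 1:] ^ r * ?p = [:- 1, 1:] ^ m * ?q"
    unfolding h using char_poly_smult_one_plus_mult_commute[of "?h X" m r "?h Y" 1] X Y
    by (simp add: sm)
  also have "\<dots> = [:- 1, 1:] ^ r * ([:- 1, 1:] ^ (m - r) * ?q)"
    using rm by (simp add: mult.assoc[symmetric] power_add[symmetric] del: mult_pCons_left)
  finally have "?p = [:- 1, 1:] ^ (m - r) * ?q"
    by (subst (asm) mult_cancel_left) simp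
  then have dvd: "[:- 1, 1:] ^ (m - r) dvd ?p" by simp
  have N': "?h (1\<^sub>m m + X * Y) \<in> carrier_mat m m" using X Y by simp
  then have p0: "?p \<noteq> 0" by (rule char_poly_nonzero)
  with dvd have "m - r \<le> Polynomial.order 1 ?p" by (simp add: order_divides)
  with p0 show ?thesis by (simp add: eigenvalues_mset_def)
qed

text \<open>For \<open>a = 0\<close> the identity reads \<open>x^m p = x^n q\<close>; the powers of
  \<open>x\<close> contribute only zero roots, which the filter removes.\<close>

lemma nonzero_eigenvalues_mset_mult_commute:
  assumes X: "X \<in> carrier_mat n m" and Y: "Y \<in> carrier_mat m n"
  shows "filter_mset (\<lambda>z. z \<noteq> 0) (eigenvalues_mset (X * Y)) =
    filter_mset (\<lambda>z. z \<noteq> 0) (eigenvalues_mset (Y * X))"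
proof -
  let ?h = "map_mat complex_of_real"
  let ?p = "char_poly (?h (X * Y))" and ?q = "char_poly (?h (Y * X))"
  have sm: "0 \<cdot>\<^sub>m 1\<^sub>m j + M = M" if "M \<in> carrier_mat j j" for j and M :: "complex mat"
    using that by (intro eq_matI) auto
  have "[:0, 1:] ^ m * ?p = [:0, 1:] ^ n * ?q"
    using char_poly_smult_one_plus_mult_commute[of "?h X" n m "?h Y" 0] X Y
    by (simp add: sm of_real_hom.mat_hom_mult[OF X Y] of_real_hom.mat_hom_mult[OF Y X])
  moreover have "?p \<noteq> 0" "?q \<noteq> 0"
    using X Y by (auto intro!: char_poly_nonzero)
  ultimately have "proots ([:0, 1:] ^ m) + proots ?p = proots ([:0, 1:] ^ n) + proots ?q"
    by (subst (1 2) proots_mult[symmetric]) auto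
  then have "filter_mset (\<lambda>z. z \<noteq> 0) (repeat_mset m {#0#} + proots ?p) =
      filter_mset (\<lambda>z. z \<noteq> 0) (repeat_mset n {#0#} + proots ?q)"
    by (simp add: proots_power)
  moreover have "filter_mset (\<lambda>z. z \<noteq> 0) (replicate_mset j (0 :: complex)) = {#}" for j
    by (induction j) auto
  ultimately show ?thesis by (simp add: eigenvalues_mset_def)
qed

subsection \<open>Block multiplication and Schur complements\<close>

lemma submatrix_one:
  assumes "I \<subseteq> {0..<n}"
  shows "submatrix (1\<^sub>m n) I I = (1\<^sub>m (card I) :: real mat)"
  using assms sel_transpose_sel[OF assms]
  by (simp add: submatrix_eq_sel[of _ n])

lemma submatrix_one_disjoint:
  assumes "I \<subseteq> {0..<n}" "J \<subseteq> {0..<n}" "I \<inter> J = {}"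
  shows "submatrix (1\<^sub>m n) I J = (0\<^sub>m (card I) (card J) :: real mat)"
  using assms sel_transpose_sel_disjoint[of I n J] by (simp add: submatrix_eq_sel[of _ n])

text \<open>The identity matrix, written as \<open>E_F E_F^T + E_G E_G^T\<close>, is inserted
  between the factors; no index has to be reordered.\<close>

lemma submatrix_mult_partition:
  fixes X Y :: "real mat"
  assumes X: "X \<in> carrier_mat n n" and Y: "Y \<in> carrier_mat n n"
    and I: "I \<subseteq> {0..<n}" and J: "J \<subseteq> {0..<n}"
    and part: "F \<union> G = {0..<n}" "F \<inter> G = {}"
  shows "submatrix (X * Y) I J =
    submatrix X I F * submatrix Y F J + submatrix X I G * submatrix Y G J"
proof -
  have F: "F \<subseteq> {0..<n}" and G: "G \<subseteq> {0..<n}" using part by auto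
  let ?L = "(sel n I)\<^sup>T * X" and ?R = "Y * sel n J"
  have L: "?L \<in> carrier_mat (card I) n" and R: "?R \<in> carrier_mat n (card J)" using X Y by auto
  have fp: "face_proj n K \<in> carrier_mat n n" for K by (simp add: face_proj_def mat_diag_def)
  have "submatrix (X * Y) I J = ?L * (1\<^sub>m n * ?R)"
    using X Y by (simp add: submatrix_eq_sel[of _ n] I J mult_assoc_dim)
  also have "\<dots> = ?L * ((face_proj n F + face_proj n G) * ?R)"
    by (simp add: face_proj_add_complement[OF part])
  also have "\<dots> = ?L * (face_proj n F * ?R) + ?L * (face_proj n G * ?R)"
    by (subst add_mult_distrib_mat[OF fp fp R], rule mult_add_distrib_mat[OF L, of _ "card J"])
      (intro mult_carrier_mat[OF fp R])+
  also have "\<dots> = submatrix X I F * submatrix Y F J + submatrix X I G * submatrix Y G J"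
    using X Y by (simp add: submatrix_eq_sel[of _ n] I J F G mult_assoc_dim
        sel_sel_transpose[symmetric])
  finally show ?thesis .
qed

lemma submatrix_carrier_subset:
  fixes A :: "real mat"
  assumes "A \<in> carrier_mat n n" "I \<subseteq> {0..<n}" "J \<subseteq> {0..<n}"
  shows "submatrix A I J \<in> carrier_mat (card I) (card J)"
  unfolding submatrix_eq_sel[OF assms] using assms by auto

lemma transpose_submatrix:
  fixes A :: "real mat"
  assumes "A \<in> carrier_mat n n" "I \<subseteq> {0..<n}" "J \<subseteq> {0..<n}"
  shows "(submatrix A I J)\<^sup>T = submatrix (A\<^sup>T) J I"
  using assms by (simp add: submatrix_eq_sel[of _ n] transpose_mult_dim mult_assoc_dim)

lemma add_eq_zero_mat_iff:
  fixes X Y :: "'a :: ab_group_add mat"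
  assumes "X \<in> carrier_mat k l" "Y \<in> carrier_mat k l"
  shows "X + Y = 0\<^sub>m k l \<longleftrightarrow> X = - Y"
  using assms by (auto simp: mat_eq_iff eq_neg_iff_add_eq_0)

lemma uminus_mult_mat:
  fixes X Y :: "'a :: ring mat"
  shows "dim_col X = dim_row Y \<Longrightarrow> (- X) * Y = - (X * Y)"
  by (intro eq_matI) (auto simp: scalar_prod_def sum_negf)

lemma mult_uminus_mat:
  fixes X Y :: "'a :: ring mat"
  shows "dim_col X = dim_row Y \<Longrightarrow> X * (- Y) = - (X * Y)"
  by (intro eq_matI) (auto simp: scalar_prod_def sum_negf)

text \<open>The \<open>F\<close> row of \<open>B A = I\<close> reads
  \<open>B_FF A_FF + B_FG A_GF = I\<close> and \<open>B_FF A_FG + B_FG A_GG = 0\<close>. Multiplying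
  the second equation by \<open>D\<close> gives \<open>B_FF A_FG D = - B_FG\<close>, which turns the
  first into the claim.\<close>

lemma inverse_block_mult_schur_complement:
  fixes A B D :: "real mat"
  assumes A: "A \<in> carrier_mat n n" and B: "B \<in> carrier_mat n n" and BA: "B * A = 1\<^sub>m n"
    and part: "F \<union> G = {0..<n}" "F \<inter> G = {}"
    and D: "D \<in> carrier_mat (card G) (card G)" "submatrix A G G * D = 1\<^sub>m (card G)"
  shows "submatrix B F F * (submatrix A F F - submatrix A F G * D * submatrix A G F) = 1\<^sub>m (card F)"
proof -
  have F: "F \<subseteq> {0..<n}" and G: "G \<subseteq> {0..<n}" using part by auto
  note c = submatrix_carrier_subset[OF A F F] submatrix_carrier_subset[OF A F G]
    submatrix_carrier_subset[OF A G F] submatrix_carrier_subset[OF A G G]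
    submatrix_carrier_subset[OF B F F] submatrix_carrier_subset[OF B F G]
  let ?V = "submatrix B F F * submatrix A F G * D"
  have FF: "submatrix B F F * submatrix A F F + submatrix B F G * submatrix A G F = 1\<^sub>m (card F)"
    using submatrix_mult_partition[OF B A F F part] by (simp add: BA submatrix_one[OF F])
  have "submatrix B F F * submatrix A F G + submatrix B F G * submatrix A G G = 0\<^sub>m (card F) (card G)"
    using submatrix_mult_partition[OF B A F G part]
    by (simp add: BA submatrix_one_disjoint[OF F G part(2)])
  then have "submatrix B F F * submatrix A F G = - (submatrix B F G * submatrix A G G)"
    using c by (subst (asm) add_eq_zero_mat_iff) auto
  then have "?V = - (submatrix B F G * (submatrix A G G * D))"
    using c D(1) by (simp add: uminus_mult_mat mult_assoc_dim)
  then have V: "?V = - submatrix B F G" using c D by simp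
  have "submatrix B F F * (submatrix A F F - submatrix A F G * D * submatrix A G F) =
      submatrix B F F * submatrix A F F - ?V * submatrix A G F"
    using c D(1) by (subst mult_minus_distrib_mat[of _ "card F" "card F" _ "card F"])
      (auto simp: mult_assoc_dim)
  also have "\<dots> = submatrix B F F * submatrix A F F + submatrix B F G * submatrix A G F"
    unfolding V using c by (intro eq_matI) (auto simp: uminus_mult_mat)
  finally show ?thesis using FF by simp
qed

theorem theorem5p2:
  fixes A A\<^sub>F\<^sub>F A\<^sub>F\<^sub>A A\<^sub>A\<^sub>F A\<^sub>A\<^sub>A S Minv :: "real mat"
    and n m r :: nat
    and F Act :: "nat set"
  assumes A: "A \<in> carrier_mat n n" "spd_mat A"
    and partition: "F \<union> Act = {0..<n}" "F \<inter> Act = {}"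
    and blocks: "A\<^sub>F\<^sub>F = submatrix A F F" "A\<^sub>F\<^sub>A = submatrix A F Act"
      "A\<^sub>A\<^sub>F = submatrix A Act F" "A\<^sub>A\<^sub>A = submatrix A Act Act"
    and Minv: "Minv = approx_face_precond A F"
    and S: "S = A\<^sub>F\<^sub>F - A\<^sub>F\<^sub>A * mat_inv A\<^sub>A\<^sub>A * A\<^sub>A\<^sub>F"
    and m: "m = card F"
    and r: "r = vec_space.rank (card Act) A\<^sub>A\<^sub>F"
  shows
    "invertible_mat A \<and> invertible_mat A\<^sub>F\<^sub>F \<and> invertible_mat A\<^sub>A\<^sub>A \<and> invertible_mat S \<and>
       invertible_mat (A\<^sub>A\<^sub>A - A\<^sub>A\<^sub>F * mat_inv A\<^sub>F\<^sub>F * A\<^sub>F\<^sub>A) \<and>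
     mat_inv S * A\<^sub>F\<^sub>F - mat_inv A\<^sub>F\<^sub>F * A\<^sub>F\<^sub>F = mat_inv S * A\<^sub>F\<^sub>F - 1\<^sub>m m \<and>
     mat_inv S * A\<^sub>F\<^sub>F - 1\<^sub>m m =
       mat_inv A\<^sub>F\<^sub>F * A\<^sub>F\<^sub>A * mat_inv (A\<^sub>A\<^sub>A - A\<^sub>A\<^sub>F * mat_inv A\<^sub>F\<^sub>F * A\<^sub>F\<^sub>A) * A\<^sub>A\<^sub>F \<and>
     filter_mset (\<lambda>z. z \<noteq> 0) (eigenvalues_mset (Minv * A)) = eigenvalues_mset (mat_inv S * A\<^sub>F\<^sub>F) \<and>
     r \<le> m \<and>
     (\<exists>ls :: real list. length ls = m \<and> sorted ls \<and>
        eigenvalues_mset (mat_inv S * A\<^sub>F\<^sub>F) = image_mset complex_of_real (mset ls) \<and>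
        (\<forall>i < m. 1 \<le> ls ! i) \<and> (\<forall>i < m - r. ls ! i = 1))"
proof -

  \<comment> \<open>Blocks of \<open>A\<close> and of its inverse \<open>B\<close>\<close>
  define k where "k = card Act"
  have F: "F \<subseteq> {0..<n}" and Act: "Act \<subseteq> {0..<n}" using partition by auto
  have partition': "Act \<union> F = {0..<n}" "Act \<inter> F = {}" using partition by auto
  have FF: "A\<^sub>F\<^sub>F \<in> carrier_mat m m" "spd_mat A\<^sub>F\<^sub>F" and AA: "A\<^sub>A\<^sub>A \<in> carrier_mat k k" "spd_mat A\<^sub>A\<^sub>A"
    unfolding blocks m k_def by (rule spd_mat_submatrix[OF A F] spd_mat_submatrix[OF A Act])+
  have FA: "A\<^sub>F\<^sub>A \<in> carrier_mat m k" and AF: "A\<^sub>A\<^sub>F \<in> carrier_mat k m"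
    unfolding blocks m k_def using A F Act by (auto intro: submatrix_carrier_subset)
  have AFt: "A\<^sub>F\<^sub>A\<^sup>T = A\<^sub>A\<^sub>F"
    unfolding blocks using A transpose_submatrix[OF A(1) F Act] by (simp add: spd_mat_def)
  note invA = spd_mat_inv[OF A] and invFF = spd_mat_inv[OF FF] and invAA = spd_mat_inv[OF AA]
  define B where "B = mat_inv A"
  note B = invA(2)[folded B_def] and AB = invA(3)[folded B_def] and BA = invA(4)[folded B_def]
  have spdB: "spd_mat B" unfolding B_def by (rule spd_mat_mat_inv[OF A])
  define B\<^sub>F\<^sub>F B\<^sub>F\<^sub>A B\<^sub>A\<^sub>A where "B\<^sub>F\<^sub>F = submatrix B F F"
    and "B\<^sub>F\<^sub>A = submatrix B F Act" and "B\<^sub>A\<^sub>A = submatrix B Act Act"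
  have BFF: "B\<^sub>F\<^sub>F \<in> carrier_mat m m"
    and BAA: "B\<^sub>A\<^sub>A \<in> carrier_mat k k" "spd_mat B\<^sub>A\<^sub>A"
    and BFA: "B\<^sub>F\<^sub>A \<in> carrier_mat m k"
    unfolding B\<^sub>F\<^sub>F_def B\<^sub>F\<^sub>A_def B\<^sub>A\<^sub>A_def m k_def
    using spd_mat_submatrix[OF B spdB F] spd_mat_submatrix[OF B spdB Act]
      submatrix_carrier_subset[OF B F Act] by auto

  \<comment> \<open>Inverses of both Schur complements as diagonal blocks of
    \<open>B\<close>\<close>
  define T where "T = A\<^sub>A\<^sub>A - A\<^sub>A\<^sub>F * mat_inv A\<^sub>F\<^sub>F * A\<^sub>F\<^sub>A"
  have T: "T \<in> carrier_mat k k" and Sc: "S \<in> carrier_mat m m"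
    unfolding T_def S using AA FF FA AF invFF invAA by auto
  have "B\<^sub>F\<^sub>F * S = 1\<^sub>m m" unfolding S blocks B\<^sub>F\<^sub>F_def m
    using invAA(2,3) unfolding blocks k_def
    by (intro inverse_block_mult_schur_complement[OF A(1) B BA partition])
  from mat_inv_unique[OF Sc BFF this]
  have S_inv: "invertible_mat S" "mat_inv S = B\<^sub>F\<^sub>F" .
  \<comment> \<open>The same lemma with the roles of \<open>F\<close> and \<open>Act\<close>
    exchanged.\<close>
  have "B\<^sub>A\<^sub>A * T = 1\<^sub>m k" unfolding T_def blocks B\<^sub>A\<^sub>A_def k_def
    using invFF(2,3) unfolding blocks m
    by (intro inverse_block_mult_schur_complement[OF A(1) B BA partition'])
  from mat_inv_unique[OF T BAA(1) this]
  have T_inv: "invertible_mat T" "mat_inv T = B\<^sub>A\<^sub>A" .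

  \<comment> \<open>The error formula\<close>
  let ?N = "B\<^sub>F\<^sub>F * A\<^sub>F\<^sub>F" and ?E = "mat_inv A\<^sub>F\<^sub>F * A\<^sub>F\<^sub>A * B\<^sub>A\<^sub>A * A\<^sub>A\<^sub>F"
  have E: "?E \<in> carrier_mat m m" using invFF FA BAA AF by auto
  \<comment> \<open>The \<open>(F, Act)\<close> block of \<open>A B = I\<close>; multiplying by
    \<open>A_FF^{-1}\<close> on the left and \<open>A_AF\<close> on the right will express
    \<open>B_FA A_AF\<close> through \<open>?E\<close>.\<close>
  have "A\<^sub>F\<^sub>F * B\<^sub>F\<^sub>A + A\<^sub>F\<^sub>A * B\<^sub>A\<^sub>A = 0\<^sub>m m k"
    using submatrix_mult_partition[OF A(1) B F Act partition]
    by (simp add: AB submatrix_one_disjoint[OF F Act partition(2)] blocks B\<^sub>F\<^sub>A_def B\<^sub>A\<^sub>A_def m k_def)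
  then have "A\<^sub>F\<^sub>F * B\<^sub>F\<^sub>A = - (A\<^sub>F\<^sub>A * B\<^sub>A\<^sub>A)"
    using FF BFA FA BAA by (subst (asm) add_eq_zero_mat_iff) auto
  then have "mat_inv A\<^sub>F\<^sub>F * (A\<^sub>F\<^sub>F * B\<^sub>F\<^sub>A) * A\<^sub>A\<^sub>F = - ?E"
    using invFF(2) FA BAA AF by (simp add: mult_uminus_mat uminus_mult_mat mult_assoc_dim)
  moreover have "mat_inv A\<^sub>F\<^sub>F * (A\<^sub>F\<^sub>F * B\<^sub>F\<^sub>A) * A\<^sub>A\<^sub>F = B\<^sub>F\<^sub>A * A\<^sub>A\<^sub>F"
    using invFF FF BFA AF by (simp add: mult_assoc_dim[symmetric])
  ultimately have BFA_AF: "B\<^sub>F\<^sub>A * A\<^sub>A\<^sub>F = - ?E" by simp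
  \<comment> \<open>The \<open>(F, F)\<close> block of \<open>B A = I\<close>.\<close>
  have one: "?N + B\<^sub>F\<^sub>A * A\<^sub>A\<^sub>F = 1\<^sub>m m"
    using submatrix_mult_partition[OF B A(1) F F partition]
    by (simp add: BA submatrix_one[OF F] blocks B\<^sub>F\<^sub>A_def B\<^sub>F\<^sub>F_def m)
  have N: "?N \<in> carrier_mat m m" using BFF FF by auto
  have "X = (X + - Y) + Y" "(X + Y) - X = Y"
    if "X \<in> carrier_mat m m" "Y \<in> carrier_mat m m" for X Y :: "real mat"
    using that by (auto intro!: eq_matI)
  from this(1)[OF N E] this(2)[OF one_carrier_mat E]
  have NE: "?N = 1\<^sub>m m + ?E" and err: "?N - 1\<^sub>m m = ?E"
    using one unfolding BFA_AF by simp_all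

  \<comment> \<open>The eigenvalues are real and at least 1\<close>
  let ?Q = "A\<^sub>F\<^sub>A * B\<^sub>A\<^sub>A * A\<^sub>A\<^sub>F"
  have Q: "?Q \<in> carrier_mat m m" using FA BAA AF by auto
  \<comment> \<open>The pencil lemma is prepared with \<open>P = A_FF\<close>: this factor cancels
    the inverse in \<open>?E\<close> and leaves the symmetric matrix \<open>?Q\<close>.\<close>
  have "A\<^sub>F\<^sub>F * ?E = (A\<^sub>F\<^sub>F * mat_inv A\<^sub>F\<^sub>F) * ?Q"
    using FF(1) invFF(2) FA BAA(1) AF by (simp add: mult_assoc_dim)
  also have "\<dots> = ?Q" unfolding invFF(3) by (rule left_mult_one_mat[OF Q])
  finally have PN: "A\<^sub>F\<^sub>F * ?N = A\<^sub>F\<^sub>F + ?Q"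
    unfolding NE using FF E by (subst mult_add_distrib_mat[of _ m m _ m]) auto
  have BAAt: "B\<^sub>A\<^sub>A\<^sup>T = B\<^sub>A\<^sub>A" and FFt: "A\<^sub>F\<^sub>F\<^sup>T = A\<^sub>F\<^sub>F" using BAA FF by (auto simp: spd_mat_def)
  have AFt': "A\<^sub>A\<^sub>F\<^sup>T = A\<^sub>F\<^sub>A" using AFt by auto
  have Qt: "?Q\<^sup>T = ?Q"
    using FA BAA AF by (simp add: transpose_mult_dim AFt AFt' BAAt mult_assoc_dim)
  have sym: "(A\<^sub>F\<^sub>F * ?N)\<^sup>T = A\<^sub>F\<^sub>F * ?N"
    unfolding PN using FF Q by (simp add: transpose_add[of _ m m] Qt FFt)
  \<comment> \<open>The form of \<open>?Q\<close> at \<open>x\<close> is that of \<open>B_AA\<close>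
    at \<open>A_AF x\<close>; this vector may vanish, so the inequality is not strict.\<close>
  have ge: "x \<bullet> (A\<^sub>F\<^sub>F *\<^sub>v x) \<le> x \<bullet> ((A\<^sub>F\<^sub>F * ?N) *\<^sub>v x)" if x: "x \<in> carrier_vec m" for x
  proof -
    let ?y = "A\<^sub>A\<^sub>F *\<^sub>v x"
    have y: "?y \<in> carrier_vec k" using AF x by auto
    have By: "B\<^sub>A\<^sub>A *\<^sub>v ?y \<in> carrier_vec k" using BAA y by auto
    have "?Q *\<^sub>v x = A\<^sub>A\<^sub>F\<^sup>T *\<^sub>v (B\<^sub>A\<^sub>A *\<^sub>v ?y)"
      using FA BAA AF x by (simp add: mult_mat_vec_assoc_dim AFt')
    then have "x \<bullet> (?Q *\<^sub>v x) = ?y \<bullet> (B\<^sub>A\<^sub>A *\<^sub>v ?y)"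
      using transpose_vec_mult_scalar[of "A\<^sub>A\<^sub>F\<^sup>T" m k "B\<^sub>A\<^sub>A *\<^sub>v ?y" x] AF x By by simp
    moreover have "?y \<bullet> (B\<^sub>A\<^sub>A *\<^sub>v ?y) \<ge> 0"
      using BAA y By by (cases "?y = 0\<^sub>v k") (auto simp: spd_mat_def less_imp_le)
    ultimately show ?thesis
      unfolding PN using FF Q x
      by (subst add_mult_distrib_mat_vec[of _ m m]) (auto simp: scalar_prod_add_distrib[of _ m])
  qed
  have real: "Im z = 0 \<and> 1 \<le> Re z" if "z \<in># eigenvalues_mset ?N" for z
    using pencil_eigenvalue_real_ge_one[OF FF N sym ge] that
    by (simp add: eigenvalue_iff_in_eigenvalues_mset[OF N])

  \<comment> \<open>Multiplicity of the eigenvalue 1\<close>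
  interpret vec_space "TYPE(real)" k .
  \<comment> \<open>The rank is at most the number of columns, so \<open>m - r\<close> is not
    truncated.\<close>
  have rm: "r \<le> m" unfolding r k_def[symmetric] by (rule rank_le_nc[OF AF])
  obtain U V where UV: "U \<in> carrier_mat k r" "V \<in> carrier_mat r m" "A\<^sub>A\<^sub>F = U * V"
    using rank_factorization[OF AF] unfolding r k_def by auto
  \<comment> \<open>Splitting \<open>A_AF\<close> as \<open>U V\<close> makes the inner dimension of
    the perturbation \<open>r\<close> instead of \<open>k\<close>.\<close>
  have "?N = 1\<^sub>m m + (mat_inv A\<^sub>F\<^sub>F * A\<^sub>F\<^sub>A * B\<^sub>A\<^sub>A * U) * V"
    unfolding NE UV(3) using invFF(2) FA BAA(1) UV(1,2) by (simp add: mult_assoc_dim)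
  moreover have "mat_inv A\<^sub>F\<^sub>F * A\<^sub>F\<^sub>A * B\<^sub>A\<^sub>A * U \<in> carrier_mat m r"
    using invFF FA BAA UV by auto
  ultimately have "m - r \<le> count (eigenvalues_mset ?N) (complex_of_real 1)"
    using count_one_eigenvalues_mset[OF _ UV(2) rm] by simp
  note ls = sorted_eigenvalue_list[OF N real this]

  \<comment> \<open>Non-zero eigenvalues of the preconditioned matrix\<close>
  let ?X = "sel n F" and ?Y = "(sel n F)\<^sup>T * B * face_proj n F * A"
  have X: "?X \<in> carrier_mat n m" and Y: "?Y \<in> carrier_mat m n" using A B by (auto simp: m)
  \<comment> \<open>With \<open>P_F = E_F E_F^T\<close>, moving \<open>E_F\<close> from the left end
    of the product to the right end turns \<open>P_F B P_F A\<close> into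
    \<open>(E_F^T B E_F) (E_F^T A E_F)\<close>.\<close>
  have "?X * ?Y = Minv * A"
    using A B unfolding Minv approx_face_precond_def B_def[symmetric]
    by (simp add: sel_sel_transpose[OF F, symmetric] mult_assoc_dim)
  moreover have "?Y * ?X = ?N"
    using A B unfolding blocks B\<^sub>F\<^sub>F_def
    by (simp add: sel_sel_transpose[OF F, symmetric] submatrix_eq_sel[of _ n] F mult_assoc_dim)
  \<comment> \<open>All eigenvalues of \<open>?N\<close> are at least 1, so the filter discards
    none.\<close>
  moreover have "filter_mset (\<lambda>z. z \<noteq> 0) (eigenvalues_mset ?N) = eigenvalues_mset ?N"
    using real by (subst filter_mset_eq_conv) force
  ultimately have flt: "filter_mset (\<lambda>z. z \<noteq> 0) (eigenvalues_mset (Minv * A)) = eigenvalues_mset ?N"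
    using nonzero_eigenvalues_mset_mult_commute[OF X Y] by simp
  show ?thesis
    unfolding T_def[symmetric] S_inv(2) T_inv(2) invFF(4)
    using invA(1) invFF(1) invAA(1) S_inv(1) T_inv(1) err flt rm ls by simp
qed

end
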